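(* For every integer $c\ge 2$ there exists a nilpotent Camina group of nilpotency class exactly $c$. Consequently, there is no bound on the nilpotency class of nilpotent groups $G$ satisfying $x^G=xG'$ for every $x\in G\setminus G'$.
   Context: For a group $G$, $G'=[G,G]$ is the commutator subgroup and $x^G$ is the conjugacy class of $x\in G$. A group $G$ (possibly infinite) is a Camina group if $G'\neq G$ and $x^G=xG'$ for every $x\in G\setminus G'$. *)

theory Defs
  imports "HOL-Algebra.Algebra"
begin

definition conjugacy_class :: "('a, 'b) monoid_scheme \<Rightarrow> 'a \<Rightarrow> 'a set" where
  "conjugacy_class G x = {inv\<^bsub>G\<^esub> g \<otimes>\<^bsub>G\<^esub> x \<otimes>\<^bsub>G\<^esub> g | g. g \<in> carrier G}"

text \<open>The commutator subgroup \<open>G'\<close> is the library's \<open>derived G (carrier G)\<close>.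
  The condition below alone allows \<open>G' = G\<close>.\<close>

definition camina_condition :: "('a, 'b) monoid_scheme \<Rightarrow> bool" where
  "camina_condition G \<longleftrightarrow>
     (\<forall>x \<in> carrier G - derived G (carrier G).
        conjugacy_class G x = x <#\<^bsub>G\<^esub> derived G (carrier G))"

definition camina_group :: "('a, 'b) monoid_scheme \<Rightarrow> bool" where
  "camina_group G \<longleftrightarrow>
     group G \<and> derived G (carrier G) \<noteq> carrier G \<and> camina_condition G"

text \<open>\<open>commutator_subgroup G H K\<close> is \<open>[H, K]\<close>, with the convention
  \<open>[h, k] = h k h\<^sup>-\<^sup>1 k\<^sup>-\<^sup>1\<close> of \<open>derived\<close>.\<close>

definition commutator_subgroup ::
    "('a, 'b) monoid_scheme \<Rightarrow> 'a set \<Rightarrow> 'a set \<Rightarrow> 'a set" where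
  "commutator_subgroup G H K =
     generate G (\<Union>h \<in> H. \<Union>k \<in> K. {h \<otimes>\<^bsub>G\<^esub> k \<otimes>\<^bsub>G\<^esub> inv\<^bsub>G\<^esub> h \<otimes>\<^bsub>G\<^esub> inv\<^bsub>G\<^esub> k})"

text \<open>The index is shifted from the usual one: \<open>lower_central G n\<close> is
  \<open>\<gamma>\<close> with index \<open>n + 1\<close>, so that the nilpotency class is the least
  \<open>n\<close> with \<open>lower_central G n\<close> trivial.\<close>

primrec lower_central :: "('a, 'b) monoid_scheme \<Rightarrow> nat \<Rightarrow> 'a set" where
  "lower_central G 0 = carrier G"
| "lower_central G (Suc n) = commutator_subgroup G (lower_central G n) (carrier G)"

lemma lower_central_one: "lower_central G (Suc 0) = derived G (carrier G)"
  by (simp add: commutator_subgroup_def derived_def)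

definition nilpotent_group :: "('a, 'b) monoid_scheme \<Rightarrow> bool" where
  "nilpotent_group G \<longleftrightarrow> group G \<and> (\<exists>n. lower_central G n = {\<one>\<^bsub>G\<^esub>})"

text \<open>Only meaningful for nilpotent groups.\<close>

definition nilpotency_class :: "('a, 'b) monoid_scheme \<Rightarrow> nat" where
  "nilpotency_class G = (LEAST n. lower_central G n = {\<one>\<^bsub>G\<^esub>})"

end

theory Submission
  imports Defs "HOL-Algebra.Algebraic_Closure_Type" "HOL-Library.Z2"
begin

text \<open>
  Let \<open>K\<close> be an algebraic closure of the field with two elements, \<open>\<sigma>\<close> its Frobenius map, and
  let \<open>K[t; \<sigma>]\<close> be the twisted polynomial ring, in which \<open>t a = \<sigma>(a) t\<close>. The group is
  \<open>1 + t K[t; \<sigma>] / (t^(n+1))\<close>, filtered by \<open>U j = {f. f = 1 mod t^(j+1)}\<close>. If \<open>x\<close> has linear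
  coefficient \<open>a \<noteq> 0\<close> and \<open>w = x mod t^(j+2)\<close>, then \<open>y x = w y\<close> can be solved with \<open>y\<close> in \<open>U j\<close>,
  one coefficient at a time: the coefficient \<open>s\<close> of \<open>t^m\<close> in \<open>y\<close> only has to satisfy
  \<open>a s^2 - a^(2^m) s = d\<close>, with \<open>d\<close> given by the previous coefficients, and quadratic equations
  are solvable in \<open>K\<close>. The case \<open>j = 0\<close> is the Camina condition; for general \<open>j\<close> the solutions
  show that the lower central series is the filtration \<open>U\<close>, so the class is \<open>n\<close>. Finally, \<open>K\<close> and
  hence the group are countable.
\<close>

section \<open>Transport along isomorphisms\<close>

lemma (in group) lower_central_subset: "lower_central G n \<subseteq> carrier G"
proof (induction n)
  case (Suc n)
  then show ?case
    unfolding lower_central.simps commutator_subgroup_def by (intro generate_incl) auto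
qed simp

text \<open>Homomorphisms send commutators to commutators and generated subgroups to generated
  subgroups; surjectivity supplies preimages for the second entries.\<close>

lemma (in group_hom) lower_central_image:
  assumes "h ` carrier G = carrier H"
  shows "lower_central H n = h ` lower_central G n"
proof (induction n)
  case (Suc n)
  let ?C = "\<Union>x \<in> lower_central G n. \<Union>k \<in> carrier G. {x \<otimes> k \<otimes> inv x \<otimes> inv k}"
  note sub = G.lower_central_subset[of n]
  have C: "?C \<subseteq> carrier G"
    using sub by auto
  have hom: "h (x \<otimes> k \<otimes> inv x \<otimes> inv k) = h x \<otimes>\<^bsub>H\<^esub> h k \<otimes>\<^bsub>H\<^esub> inv\<^bsub>H\<^esub> h x \<otimes>\<^bsub>H\<^esub> inv\<^bsub>H\<^esub> h k"
    if "x \<in> lower_central G n" "k \<in> carrier G" for x k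
    using that sub by (simp add: subset_iff)
  have "lower_central H (Suc n) = generate H
     (\<Union>x \<in> lower_central G n. \<Union>k \<in> carrier G.
        {h x \<otimes>\<^bsub>H\<^esub> h k \<otimes>\<^bsub>H\<^esub> inv\<^bsub>H\<^esub> h x \<otimes>\<^bsub>H\<^esub> inv\<^bsub>H\<^esub> h k})"
    by (simp add: commutator_subgroup_def Suc flip: assms)
  also have "\<dots> = generate H (h ` ?C)"
    using hom by (simp add: image_UN)
  also have "\<dots> = h ` generate G ?C"
    by (rule generate_img[OF C])
  finally show ?case
    by (simp add: commutator_subgroup_def)
qed (simp add: assms)

lemma (in group_hom) camina_condition_image:
  assumes surj: "h ` carrier G = carrier H" and cam: "camina_condition G"
  shows "camina_condition H"
  unfolding camina_condition_def
proof
  have D: "derived H (carrier H) = h ` derived G (carrier G)"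
    using lower_central_image[OF surj, of "Suc 0"] unfolding lower_central_one .
  have Dsub: "derived G (carrier G) \<subseteq> carrier G"
    using G.lower_central_subset[of "Suc 0"] unfolding lower_central_one .
  fix z assume z: "z \<in> carrier H - derived H (carrier H)"
  then have "z \<in> h ` carrier G"
    by (simp add: surj)
  \<comment> \<open>The preimage lies outside \<open>derived G (carrier G)\<close> because the image
    of that subgroup is the derived subgroup of \<open>H\<close>, which misses
    \<open>z\<close>.\<close>
  then obtain x where x: "x \<in> carrier G" "x \<notin> derived G (carrier G)" "z = h x"
    using z unfolding D by blast
  have "conjugacy_class H z = {inv\<^bsub>H\<^esub> h g \<otimes>\<^bsub>H\<^esub> h x \<otimes>\<^bsub>H\<^esub> h g | g. g \<in> carrier G}"
    unfolding conjugacy_class_def x(3) surj[symmetric] by blast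
  also have "\<dots> = h ` conjugacy_class G x"
  proof -
    have "h (inv g \<otimes> x \<otimes> g) = inv\<^bsub>H\<^esub> h g \<otimes>\<^bsub>H\<^esub> h x \<otimes>\<^bsub>H\<^esub> h g" if "g \<in> carrier G" for g
      using that x(1) by simp
    then have "{inv\<^bsub>H\<^esub> h g \<otimes>\<^bsub>H\<^esub> h x \<otimes>\<^bsub>H\<^esub> h g | g. g \<in> carrier G} =
        (\<lambda>g. h (inv g \<otimes> x \<otimes> g)) ` carrier G"
      unfolding setcompr_eq_image by (intro image_cong) simp_all
    then show ?thesis
      unfolding conjugacy_class_def by (simp add: setcompr_eq_image image_image)
  qed
  also have "\<dots> = h ` (x <# derived G (carrier G))"
    using cam x by (simp add: camina_condition_def)
  also have "\<dots> = z <#\<^bsub>H\<^esub> derived H (carrier H)"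
  proof -
    have "h (x \<otimes> d) = h x \<otimes>\<^bsub>H\<^esub> h d" if "d \<in> derived G (carrier G)" for d
      using that x(1) Dsub by auto
    then show ?thesis
      unfolding l_coset_def D x(3) by (simp add: image_UN)
  qed
  finally show "conjugacy_class H z = z <#\<^bsub>H\<^esub> derived H (carrier H)" .
qed

text \<open>The theorem speaks of groups of type \<open>nat monoid\<close>, so the structure of a
  countable group is moved along an enumeration of its carrier.\<close>

lemma (in group) countable_imp_nat_copy:
  assumes "countable (carrier G)"
  obtains H :: "nat monoid" and h
  where "group_hom G H h" "h ` carrier G = carrier H" "inj_on h (carrier G)"
proof -
  define e where "e = to_nat_on (carrier G)"
  define d where "d = from_nat_into (carrier G)"
  have inj: "inj_on e (carrier G)"
    unfolding e_def by (rule inj_on_to_nat_on[OF assms])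
  have de [simp]: "d (e x) = x" if "x \<in> carrier G" for x
    using that assms by (simp add: d_def e_def)
  define H :: "nat monoid" where
    "H = \<lparr>carrier = e ` carrier G, monoid.mult = (\<lambda>x y. e (d x \<otimes> d y)), one = e \<one>\<rparr>"
  have "group H"
  proof (rule groupI)
    fix x assume "x \<in> carrier H"
    then obtain a where a: "a \<in> carrier G" "x = e a"
      by (auto simp: H_def)
    then show "\<exists>y\<in>carrier H. y \<otimes>\<^bsub>H\<^esub> x = \<one>\<^bsub>H\<^esub>"
      by (intro bexI[of _ "e (inv a)"]) (auto simp: H_def)
  qed (auto simp: H_def m_assoc)
  moreover have "e \<in> hom G H"
    by (auto simp: hom_def H_def)
  ultimately have "group_hom G H e"
    by (simp add: group_hom_def group_hom_axioms_def is_group)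
  then show ?thesis
    by (rule that) (simp_all add: H_def inj)
qed


section \<open>Truncated twisted polynomials with constant term one\<close>

text \<open>The function \<open>f\<close> stands for the sum of the \<open>f i\<close> t^i; the
  exponent \<open>2 ^ i\<close> comes from t^i a = a^(2^i) t^i. The zeros beyond \<open>n\<close>
  pick one representative of each class modulo t^(n+1).\<close>

definition twisted_units :: "nat \<Rightarrow> (nat \<Rightarrow> 'a::comm_ring_1) monoid" where
  "twisted_units n =
     \<lparr>carrier = {f. f 0 = 1 \<and> (\<forall>k>n. f k = 0)},
      monoid.mult = (\<lambda>f g k. if k \<le> n then \<Sum>i=0..k. f i * g (k - i) ^ 2 ^ i else 0),
      one = (\<lambda>k. of_bool (k = 0))\<rparr>"

locale twisted =
  fixes n :: nat and G :: "(nat \<Rightarrow> 'a::alg_closed_field) monoid" (structure)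
  assumes two_eq_0: "(2::'a) = 0"
    and G_def: "G = twisted_units n"
begin

section \<open>Group axioms\<close>

lemma carrier_iff: "f \<in> carrier G \<longleftrightarrow> f 0 = 1 \<and> (\<forall>k>n. f k = 0)"
  by (simp add: G_def twisted_units_def)

lemma one_nth: "\<one> k = of_bool (k = 0)"
  by (simp add: G_def twisted_units_def)

lemma mult_nth: "k \<le> n \<Longrightarrow> (f \<otimes> g) k = (\<Sum>i=0..k. f i * g (k - i) ^ 2 ^ i)"
  by (simp add: G_def twisted_units_def)

lemma mult_nth_big: "k > n \<Longrightarrow> (f \<otimes> g) k = 0"
  by (simp add: G_def twisted_units_def)

lemma frobenius_add: "(x + y :: 'a) ^ 2 ^ i = x ^ 2 ^ i + y ^ 2 ^ i"
proof (induction i)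
  case (Suc i)
  have "(x + y) ^ 2 ^ Suc i = ((x + y) ^ 2 ^ i)\<^sup>2"
    by (simp add: power_mult mult.commute[of 2] flip: power_mult)
  also have "\<dots> = (x ^ 2 ^ i)\<^sup>2 + (y ^ 2 ^ i)\<^sup>2"
    using two_eq_0 by (simp add: Suc power2_sum)
  finally show ?case
    by (simp add: power_mult mult.commute[of 2] flip: power_mult)
qed simp

lemma frobenius_sum: "(\<Sum>i\<in>A. f i :: 'a) ^ 2 ^ k = (\<Sum>i\<in>A. f i ^ 2 ^ k)"
  by (induction A rule: infinite_finite_induct) (simp_all add: frobenius_add)

lemma mult_closed: "f \<in> carrier G \<Longrightarrow> g \<in> carrier G \<Longrightarrow> f \<otimes> g \<in> carrier G"
  by (simp add: carrier_iff mult_nth mult_nth_big)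

text \<open>Powers with exponent \<open>2 ^ j\<close> distribute over the inner sum by additivity of
  the Frobenius map, and the exponents match since 2^j 2^i = 2^(j+i).\<close>

lemma mult_assoc: "(f \<otimes> g) \<otimes> h = f \<otimes> (g \<otimes> h)"
proof
  fix k
  show "((f \<otimes> g) \<otimes> h) k = (f \<otimes> (g \<otimes> h)) k"
  proof (cases "k \<le> n")
    case True
    have "((f \<otimes> g) \<otimes> h) k = (\<Sum>j=0..k. (\<Sum>i=0..j. f i * g (j - i) ^ 2 ^ i) * h (k - j) ^ 2 ^ j)"
      using True by (simp add: mult_nth)
    \<comment> \<open>The exponent \<open>j\<close> is split as \<open>i + (j - i)\<close> to give
      the summand the form of the reindexing rule.\<close>
    also have "\<dots> = (\<Sum>j=0..k. \<Sum>i=0..j. f i * g (j - i) ^ 2 ^ i * h (k - j) ^ 2 ^ (i + (j - i)))"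
      by (simp add: sum_distrib_right)
    also have "\<dots> = (\<Sum>j=0..k. \<Sum>i=0..k - j. f j * g i ^ 2 ^ j * h (k - j - i) ^ 2 ^ (j + i))"
      by (rule fps_mult_assoc_lemma[of "\<lambda>a b c. f a * g b ^ 2 ^ a * h c ^ 2 ^ (a + b)"])
    also have "\<dots> = (\<Sum>j=0..k. f j * (\<Sum>i=0..k - j. g i * h (k - j - i) ^ 2 ^ i) ^ 2 ^ j)"
      by (simp add: frobenius_sum sum_distrib_left power_mult_distrib power_add mult.assoc
          mult.commute[of "2 ^ _" "2 ^ _"] flip: power_mult)
    also have "\<dots> = (f \<otimes> (g \<otimes> h)) k"
      using True by (simp add: mult_nth)
    finally show ?thesis .
  qed (simp add: mult_nth_big)
qed

lemma one_mult: assumes "f \<in> carrier G" shows "\<one> \<otimes> f = f"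
proof
  fix k show "(\<one> \<otimes> f) k = f k"
    using assms
    by (cases "k \<le> n") (simp_all add: mult_nth mult_nth_big one_nth carrier_iff sum.atLeast_Suc_atMost)
qed

text \<open>As \<open>x 0 = 1\<close>, coefficient \<open>k\<close> of the product is
  \<open>y k\<close> plus terms in earlier coefficients of \<open>y\<close>, so \<open>y\<close> can
  be defined recursively.\<close>

lemma left_inverse_exists:
  assumes x: "x \<in> carrier G"
  shows "\<exists>y\<in>carrier G. y \<otimes> x = \<one>"
proof -
  have "\<exists>y. \<forall>k. y k =
      (if k = 0 then 1 else if k \<le> n then - (\<Sum>i<k. y i * x (k - i) ^ 2 ^ i) else 0)"
    by (rule dependent_wellorder_choice) auto
  then obtain y where y:
    "y k = (if k = 0 then 1 else if k \<le> n then - (\<Sum>i<k. y i * x (k - i) ^ 2 ^ i) else 0)" for k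
    by blast
  have "(y \<otimes> x) k = \<one> k" for k
  proof (cases "k \<le> n \<and> k > 0")
    case True
    have "(y \<otimes> x) k = (\<Sum>i<k. y i * x (k - i) ^ 2 ^ i) + y k"
      using True x by (simp add: mult_nth carrier_iff atLeast0AtMost flip: lessThan_Suc_atMost)
    then show ?thesis
      using True by (subst (asm) (2) y) (simp add: one_nth)
  next
    case False
    have "y 0 = 1"
      by (subst y) simp
    with False x show ?thesis
      by (cases "k = 0") (simp_all add: one_nth mult_nth mult_nth_big carrier_iff)
  qed
  moreover have "y \<in> carrier G"
    unfolding carrier_iff by (subst y, simp, intro allI impI, subst y, simp)
  ultimately show ?thesis
    by blast
qed

sublocale group G
  by (rule groupI)
     (simp_all add: mult_closed mult_assoc one_mult left_inverse_exists, simp add: carrier_iff one_nth)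

section \<open>The filtration by powers of t\<close>

definition U :: "nat \<Rightarrow> (nat \<Rightarrow> 'a) set" where
  "U j = {f \<in> carrier G. \<forall>i. 0 < i \<and> i \<le> j \<longrightarrow> f i = 0}"

lemma U_0: "U 0 = carrier G"
  by (auto simp: U_def)

lemma U_subset: "U j \<subseteq> carrier G"
  by (auto simp: U_def)

text \<open>In every inner term of the convolution the index of \<open>f\<close> lies strictly
  between 0 and \<open>k\<close>; only the two ends survive, where the constant terms are 1.\<close>

lemma mult_nth_leading:
  assumes f: "f \<in> carrier G" and g: "g \<in> carrier G" and k: "0 < k"
    and 0: "\<And>i. 0 < i \<Longrightarrow> i < k \<Longrightarrow> f i = 0"
  shows "(f \<otimes> g) k = f k + g k" "(g \<otimes> f) k = g k + f k"
proof -
  have split: "(\<Sum>i=0..k. F i) = F 0 + (\<Sum>i=1..<k. F i) + F k" for F :: "nat \<Rightarrow> 'a"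
  proof -
    from k obtain m where m: "k = Suc m"
      by (cases k) auto
    show ?thesis
      using sum.atLeast_Suc_atMost[of 0 m F]
      by (simp add: m atLeastLessThanSuc_atLeastAtMost)
  qed
  show "(f \<otimes> g) k = f k + g k"
  proof (cases "k \<le> n")
    case True
    then show ?thesis
      using f g 0 k by (simp add: mult_nth split carrier_iff power_0_left)
  qed (use f g in \<open>simp add: mult_nth_big carrier_iff\<close>)
  show "(g \<otimes> f) k = g k + f k"
  proof (cases "k \<le> n")
    case True
    then show ?thesis
      using f g 0 k by (simp add: mult_nth split carrier_iff power_0_left)
  qed (use f g in \<open>simp add: mult_nth_big carrier_iff\<close>)
qed

text \<open>A membership test by congruence modulo t^(m+1): a \<open>b\<close> that cancels the
  inverses in \<open>u\<close> spares the computation of their coefficients.\<close>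

lemma mem_U_iff_agree:
  assumes u: "u \<in> carrier G" and b: "b \<in> carrier G"
  shows "u \<in> U m \<longleftrightarrow> (\<forall>i\<le>m. (u \<otimes> b) i = b i)"
proof
  assume U: "u \<in> U m"
  show "\<forall>i\<le>m. (u \<otimes> b) i = b i"
  proof (intro allI impI)
    fix i assume "i \<le> m"
    then show "(u \<otimes> b) i = b i"
      using U u b mult_closed[OF u b]
      by (cases "i = 0") (simp_all add: U_def mult_nth_leading carrier_iff)
  qed
next
  assume agree: "\<forall>i\<le>m. (u \<otimes> b) i = b i"
  have "0 < i \<and> i \<le> m \<longrightarrow> u i = 0" for i
  proof (induction i rule: less_induct)
    case (less i)
    then show ?case
      using agree mult_nth_leading(1)[OF u b, of i] by auto
  qed
  then show "u \<in> U m"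
    using u by (simp add: U_def)
qed

lemma U_subgroup: "subgroup (U m) G"
proof (rule subgroupI)
  show "U m \<subseteq> carrier G" "U m \<noteq> {}"
    using U_subset one_closed by (auto simp: U_def one_nth)
next
  fix a assume a: "a \<in> U m"
  then have "a \<in> carrier G"
    using U_subset by blast
  \<comment> \<open>The product of \<open>inv a\<close> and \<open>a\<close> is the identity, which
    agrees with \<open>a\<close> up to degree \<open>m\<close>; so the test applies with
    \<open>b = a\<close>.\<close>
  then show "inv a \<in> U m"
    using a mem_U_iff_agree[of a "\<one>" m] mem_U_iff_agree[of "inv a" a m] by simp
next
  fix a b assume ab: "a \<in> U m" "b \<in> U m"
  then have "a \<in> carrier G" "b \<in> carrier G"
    using U_subset by blast+
  then show "a \<otimes> b \<in> U m"
    using ab mem_U_iff_agree[of a b m] mem_U_iff_agree[of b "\<one>" m]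
      mem_U_iff_agree[of "a \<otimes> b" "\<one>" m] by simp
qed

text \<open>The commutator c satisfies c (g f) = f g, and in positive degrees up to
  \<open>Suc j\<close> both products have coefficient \<open>f i + g i\<close>.\<close>

lemma commutator_mem_U:
  assumes f: "f \<in> U j" and g: "g \<in> carrier G"
  shows "f \<otimes> g \<otimes> inv f \<otimes> inv g \<in> U (Suc j)"
proof -
  have fG: "f \<in> carrier G"
    using f U_subset by blast
  let ?c = "f \<otimes> g \<otimes> inv f \<otimes> inv g"
  have "?c \<otimes> (g \<otimes> f) = f \<otimes> g"
    using fG g by (simp add: m_assoc inv_solve_left')
  moreover have "(f \<otimes> g) i = (g \<otimes> f) i" if "i \<le> Suc j" for i
  proof (cases "i = 0")
    case True
    then show ?thesis
      using mult_closed[OF fG g] mult_closed[OF g fG] by (simp add: carrier_iff)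
  next
    case False
    then show ?thesis
      using that f by (simp add: mult_nth_leading[OF fG g] U_def add.commute)
  qed
  ultimately show ?thesis
    using fG g mem_U_iff_agree[of ?c "g \<otimes> f" "Suc j"] by simp
qed

section \<open>Solving the conjugacy equation\<close>

lemma quadratic_root:
  assumes "(a::'a) \<noteq> 0"
  shows "\<exists>s. a * s\<^sup>2 - b * s = d"
proof -
  have "\<exists>s. (\<Sum>k\<le>2. (if k = 0 then - d else if k = 1 then - b else a) * s ^ k) = 0"
    using assms by (intro alg_closed) auto
  then show ?thesis
    by (auto simp: numeral_2_eq_2 algebra_simps)
qed

text \<open>In degree \<open>Suc m\<close> the coefficient \<open>y (Suc m)\<close> has factor 1 on
  both sides and cancels, which leaves a quadratic equation for \<open>y m\<close>.\<close>

lemma conjugate_solvable: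
  assumes x: "x \<in> carrier G" and x1: "x 1 \<noteq> 0" and w: "w \<in> carrier G"
    and agree: "\<And>i. i \<le> Suc j \<Longrightarrow> w i = x i"
  obtains y where "y \<in> U j" "y \<otimes> x = w \<otimes> y"
proof -
  \<comment> \<open>\<open>D f m\<close> collects what the coefficients below \<open>m\<close>
    contribute to y x - w y in degree \<open>Suc m\<close>.\<close>
  define D :: "(nat \<Rightarrow> 'a) \<Rightarrow> nat \<Rightarrow> 'a" where "D f m =
    (\<Sum>i<m. f i * x (Suc m - i) ^ 2 ^ i - w (Suc m - i) * f i ^ 2 ^ (Suc m - i))" for f m
  have "\<exists>y. \<forall>m. (m = 0 \<longrightarrow> y m = 1) \<and> (0 < m \<and> m \<le> j \<longrightarrow> y m = 0) \<and>
     x 1 * (y m)\<^sup>2 - x 1 ^ 2 ^ m * y m = D y m" (is "\<exists>y. \<forall>m. ?P y m (y m)")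
  proof (rule dependent_wellorder_choice[where P = ?P])
    fix s and f g :: "nat \<Rightarrow> 'a" and m
    assume "\<And>i. i < m \<Longrightarrow> f i = g i"
    then have "D f m = D g m"
      unfolding D_def by (intro sum.cong) auto
    then show "?P f m s = ?P g m s"
      by simp
  next
    fix m and f :: "nat \<Rightarrow> 'a" assume IH: "\<And>i. i < m \<Longrightarrow> ?P f i (f i)"
    consider "m = 0" | "0 < m" "m \<le> j" | "m > j" "m > 0"
      by linarith
    then show "\<exists>s. ?P f m s"
    proof cases
      case 1
      then show ?thesis
        by (intro exI[of _ 1]) (simp add: D_def)
    next
      case 2
      \<comment> \<open>Only \<open>i = 0\<close> survives, leaving
        \<open>x (Suc m) - w (Suc m)\<close>. This vanishes as \<open>Suc m \<le> Suc j\<close>,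
        whence the range of the agreement hypothesis.\<close>
      have "D f m = (\<Sum>i\<in>{0}. f i * x (Suc m - i) ^ 2 ^ i - w (Suc m - i) * f i ^ 2 ^ (Suc m - i))"
        unfolding D_def using IH 2 by (intro sum.mono_neutral_right) auto
      also have "\<dots> = 0"
        using IH[of 0] 2 agree[of "Suc m"] by simp
      finally show ?thesis
        using 2 by (intro exI[of _ 0]) simp
    next
      case 3
      then show ?thesis
        using quadratic_root[OF x1, of "x 1 ^ 2 ^ m" "D f m"] by auto
    qed
  qed
  then obtain z where z: "?P z m (z m)" for m
    by blast
  \<comment> \<open>The recursion for \<open>z\<close> runs through all degrees; cutting it off at
    \<open>n\<close> gives a group element and leaves products in degrees up to \<open>n\<close>
    unchanged.\<close>
  define y where "y k = (if k \<le> n then z k else 0)" for k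
  have yU: "y \<in> U j"
    using z by (auto simp: U_def carrier_iff y_def)
  have w1: "w 1 = x 1"
    using agree by simp
  have "(y \<otimes> x) k = (w \<otimes> y) k" for k
  proof -
    consider "k > n" | "k = 0" | m where "k = Suc m" "k \<le> n"
      by (metis not_le not0_implies_Suc)
    then show ?thesis
    proof cases
      case (3 m)
      have "(y \<otimes> x) k = (\<Sum>i=0..k. z i * x (k - i) ^ 2 ^ i)"
        using 3 by (simp add: mult_nth y_def)
      also have "\<dots> = (\<Sum>i<m. z i * x (Suc m - i) ^ 2 ^ i) + z m * x 1 ^ 2 ^ m + z (Suc m)"
        using 3 x by (simp add: carrier_iff atLeast0AtMost flip: lessThan_Suc_atMost)
      finally have 1: "(y \<otimes> x) k = \<dots>" .
      have "(w \<otimes> y) k = (\<Sum>i=0..k. w i * z (k - i) ^ 2 ^ i)"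
        unfolding mult_nth[OF \<open>k \<le> n\<close>] using \<open>k \<le> n\<close> by (intro sum.cong) (auto simp: y_def)
      also have "\<dots> = (\<Sum>i=0..k. w (k - i) * z i ^ 2 ^ (k - i))"
        by (rule sum.reindex_bij_witness[where i = "(-) k" and j = "(-) k"]) auto
      also have "\<dots> = (\<Sum>i<m. w (Suc m - i) * z i ^ 2 ^ (Suc m - i)) + x 1 * (z m)\<^sup>2 + z (Suc m)"
        using 3 w w1 by (simp add: carrier_iff atLeast0AtMost flip: lessThan_Suc_atMost)
      finally have 2: "(w \<otimes> y) k = \<dots>" .
      show ?thesis
        using z[of m] unfolding 1 2 D_def sum_subtractf by (simp add: algebra_simps)
    qed (use yU x w in \<open>simp_all add: mult_nth mult_nth_big U_def carrier_iff\<close>)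
  qed
  then show ?thesis
    using yU that by blast
qed

text \<open>With \<open>w = g \<otimes> x\<close>, the equation y x = w y says that the commutator
  of \<open>y\<close> and \<open>x\<close> is \<open>g\<close>.\<close>

lemma commutator_solvable:
  assumes x: "x \<in> carrier G" and x1: "x 1 \<noteq> 0" and g: "g \<in> U (Suc j)"
  obtains y where "y \<in> U j" "y \<otimes> x \<otimes> inv y \<otimes> inv x = g"
proof -
  have gG: "g \<in> carrier G"
    using g U_subset by blast
  have "(g \<otimes> x) i = x i" if "i \<le> Suc j" for i
    using that g mem_U_iff_agree[OF gG x] by blast
  then obtain y where y: "y \<in> U j" "y \<otimes> x = g \<otimes> x \<otimes> y"
    using conjugate_solvable[OF x x1, of "g \<otimes> x" j] x gG by auto
  have "y \<in> carrier G"
    using y U_subset by blast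
  then have "y \<otimes> x \<otimes> inv y \<otimes> inv x = g"
    using x gG by (simp add: y(2) m_assoc)
  with y(1) show ?thesis
    using that by blast
qed

section \<open>Lower central series and Camina condition\<close>

lemma linear_mem: "n \<ge> 1 \<Longrightarrow> (\<lambda>k. of_bool (k \<le> 1)) \<in> carrier G"
  by (simp add: carrier_iff)

text \<open>Each element of \<open>U (Suc j)\<close> is a single commutator of some \<open>y\<close>
  in \<open>U j\<close> with 1 + t, whose linear coefficient is 1; the other inclusion is
  \<open>commutator_mem_U\<close>.\<close>

lemma lower_central_eq_U:
  assumes "n \<ge> 1"
  shows "lower_central G j = U j"
proof (induction j)
  case (Suc j)
  let ?C = "\<Union>f \<in> U j. \<Union>g \<in> carrier G. {f \<otimes> g \<otimes> inv f \<otimes> inv g}"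
  have "generate G ?C = U (Suc j)"
  proof
    show "generate G ?C \<subseteq> U (Suc j)"
      using commutator_mem_U by (intro generate_subgroup_incl U_subgroup) blast
    show "U (Suc j) \<subseteq> generate G ?C"
    proof
      fix g assume "g \<in> U (Suc j)"
      then obtain y where "y \<in> U j"
        "y \<otimes> (\<lambda>k. of_bool (k \<le> 1)) \<otimes> inv y \<otimes> inv (\<lambda>k. of_bool (k \<le> 1)) = g"
        using commutator_solvable[OF linear_mem[OF assms]] by auto
      then have "g \<in> ?C"
        using linear_mem[OF assms] by blast
      then show "g \<in> generate G ?C"
        by (rule generate.incl)
    qed
  qed
  then show ?case
    by (simp add: commutator_subgroup_def Suc)
qed (simp add: U_0)

lemma derived_eq_U: "n \<ge> 1 \<Longrightarrow> derived G (carrier G) = U (Suc 0)"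
  using lower_central_eq_U[of "Suc 0"] unfolding lower_central_one .

lemma camina_condition_twisted:
  assumes "n \<ge> 1"
  shows "camina_condition G"
  unfolding camina_condition_def derived_eq_U[OF assms]
proof
  fix x assume "x \<in> carrier G - U (Suc 0)"
  then have x: "x \<in> carrier G" and x1: "x 1 \<noteq> 0"
    by (auto simp: U_def le_Suc_eq)
  show "conjugacy_class G x = x <# U (Suc 0)"
  proof
    show "conjugacy_class G x \<subseteq> x <# U (Suc 0)"
    proof
      fix z assume "z \<in> conjugacy_class G x"
      then obtain g where g: "g \<in> carrier G" "z = inv g \<otimes> x \<otimes> g"
        by (auto simp: conjugacy_class_def)
      \<comment> \<open>This is the commutator of \<open>inv x\<close> and \<open>inv g\<close> in
        the convention h k h^-1 k^-1.\<close>
      have "inv x \<otimes> inv g \<otimes> x \<otimes> g \<in> U (Suc 0)"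
        using commutator_mem_U[of "inv x" 0 "inv g"] x g by (simp add: U_0)
      moreover have "z = x \<otimes> (inv x \<otimes> inv g \<otimes> x \<otimes> g)"
        using x g by (simp add: m_assoc[symmetric])
      ultimately show "z \<in> x <# U (Suc 0)"
        by (auto simp: l_coset_def)
    qed
    show "x <# U (Suc 0) \<subseteq> conjugacy_class G x"
    proof
      fix z assume "z \<in> x <# U (Suc 0)"
      then obtain h where h: "h \<in> U (Suc 0)" "z = x \<otimes> h"
        by (auto simp: l_coset_def)
      have hG: "h \<in> carrier G"
        using h U_subset by blast
      have "(x \<otimes> h) i = x i" if "i \<le> Suc 0" for i
      proof (cases "i = 0")
        case True
        then show ?thesis
          using mult_closed[OF x hG] x by (simp add: carrier_iff)
      next
        case False
        then have "i = 1"
          using that by simp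
        then show ?thesis
          using h mult_nth_leading(2)[OF hG x, of 1] by (simp add: U_def)
      qed
      then obtain y where y: "y \<in> U 0" "y \<otimes> x = x \<otimes> h \<otimes> y"
        using conjugate_solvable[OF x x1, of "x \<otimes> h" 0] x hG by auto
      have yG: "y \<in> carrier G"
        using y U_0 by blast
      then have "y \<otimes> x \<otimes> inv y = z"
        using x hG h(2) by (simp add: y(2) m_assoc)
      \<comment> \<open>The class is defined by \<open>inv g \<otimes> x \<otimes> g\<close>, hence
        the witness \<open>inv y\<close>.\<close>
      then show "z \<in> conjugacy_class G x"
        using yG unfolding conjugacy_class_def by (auto intro!: exI[of _ "inv y"])
    qed
  qed
qed

lemma derived_neq_carrier:
  assumes "n \<ge> 1"
  shows "derived G (carrier G) \<noteq> carrier G"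
proof -
  have "(\<lambda>k. of_bool (k \<le> 1)) \<notin> U (Suc 0)"
    by (auto simp: U_def)
  then show ?thesis
    using linear_mem[OF assms] derived_eq_U[OF assms] by blast
qed

lemma U_trivial_iff:
  assumes "n \<ge> 1"
  shows "U j = {\<one>} \<longleftrightarrow> n \<le> j"
proof
  assume triv: "U j = {\<one>}"
  show "n \<le> j"
  proof (rule ccontr)
    assume "\<not> n \<le> j"
    \<comment> \<open>The element 1 + t^n, nontrivial and in \<open>U j\<close> for
      \<open>j < n\<close>.\<close>
    then have "(\<lambda>k. of_bool (k = 0 \<or> k = n)) \<in> U j"
      by (auto simp: U_def carrier_iff)
    then have "(\<lambda>k. of_bool (k = 0 \<or> k = n)) = \<one>"
      using triv by blast
    from fun_cong[OF this, of n] show False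
      using assms by (simp add: one_nth)
  qed
next
  assume "n \<le> j"
  have "f = \<one>" if f: "f \<in> U j" for f
  proof
    fix k show "f k = \<one> k"
      using f \<open>n \<le> j\<close> by (cases "k = 0"; cases "k \<le> n") (auto simp: U_def carrier_iff one_nth)
  qed
  then show "U j = {\<one>}"
    using subgroup.one_closed[OF U_subgroup] by blast
qed

text \<open>An element is determined by the list of its \<open>n + 1\<close> coefficients of degree
  at most \<open>n\<close>.\<close>

lemma countable_carrier:
  assumes "countable (UNIV :: 'a set)"
  shows "countable (carrier G)"
proof (rule countableI'[of "\<lambda>f. to_nat_on (lists (UNIV :: 'a set)) (map f [0..<Suc n])"])
  have cnt: "countable (lists (UNIV :: 'a set))"
    using assms by (rule countable_lists)
  show "inj_on (\<lambda>f. to_nat_on (lists (UNIV :: 'a set)) (map f [0..<Suc n])) (carrier G)"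
  proof (rule inj_onI)
    fix f g assume fg: "f \<in> carrier G" "g \<in> carrier G"
      "to_nat_on (lists (UNIV :: 'a set)) (map f [0..<Suc n]) =
       to_nat_on (lists (UNIV :: 'a set)) (map g [0..<Suc n])"
    then have "map f [0..<Suc n] = map g [0..<Suc n]"
      using cnt by simp
    then have "\<forall>k\<le>n. f k = g k"
      by (auto simp: less_Suc_eq_le)
    then show "f = g"
      using fg by (intro ext) (metis carrier_iff not_le)
  qed
qed

end


section \<open>A countable algebraically closed field of characteristic two\<close>

lemma countable_bit: "countable (UNIV :: bit set)"
proof -
  have "x = 0 \<or> x = 1" for x :: bit
    by (cases x) simp_all
  then have "UNIV = {0, 1 :: bit}"
    by blast
  then show ?thesis
    by (metis countable_empty countable_insert)
qed

lemma countable_poly: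
  assumes "countable (UNIV :: 'a::zero set)"
  shows "countable (UNIV :: 'a poly set)"
proof -
  have "UNIV = Poly ` lists (UNIV :: 'a set)"
    by (metis Poly_coeffs UNIV_I UNIV_eq_I image_eqI lists_UNIV)
  then show ?thesis
    using assms by (metis countable_image countable_lists)
qed

text \<open>Every element is a root of one of countably many nonzero polynomials over the base
  field, each with finitely many roots.\<close>

lemma countable_alg_closure:
  assumes "countable (UNIV :: 'a::field set)"
  shows "countable (UNIV :: 'a alg_closure set)"
proof -
  have "UNIV = (\<Union>p \<in> {p :: 'a poly. p \<noteq> 0}. {x. poly (map_poly to_ac p) x = 0})"
    using alg_closure_algebraic by blast
  moreover have "countable {x. poly (map_poly to_ac p) x = 0}" if "p \<noteq> 0" for p :: "'a poly"
  proof -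
    have "map_poly to_ac p \<noteq> 0"
      using that by (simp add: map_poly_eq_0_iff)
    then show ?thesis
      by (intro countable_finite poly_roots_finite)
  qed
  ultimately show ?thesis
    using countable_subset[OF subset_UNIV countable_poly[OF assms]]
    by (metis (mono_tags, lifting) countable_UN mem_Collect_eq)
qed

section \<open>Examples of every positive class on the natural numbers\<close>

lemma camina_group_of_class:
  assumes c: "c \<ge> 1"
  shows "\<exists>H :: nat monoid. nilpotent_group H \<and> camina_group H \<and> nilpotency_class H = c"
proof -
  define G :: "(nat \<Rightarrow> bit alg_closure) monoid" where "G = twisted_units c"
  \<comment> \<open>In \<open>bit\<close> the number 2 is 0, and \<open>to_ac\<close> carries this
    to the closure.\<close>
  have "(2 :: bit alg_closure) = to_ac 2"
    by (simp only: to_ac_numeral)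
  then interpret twisted c G
    by unfold_locales (simp_all add: G_def)
  obtain H :: "nat monoid" and h
    where "group_hom G H h" and surj: "h ` carrier G = carrier H" and inj: "inj_on h (carrier G)"
    using countable_imp_nat_copy[OF countable_carrier[OF countable_alg_closure[OF countable_bit]]]
    by blast
  then interpret h: group_hom G H h
    by simp
  have lc: "lower_central H j = h ` U j" for j
    using h.lower_central_image[OF surj] lower_central_eq_U[OF c] by simp
  have triv: "lower_central H j = {\<one>\<^bsub>H\<^esub>} \<longleftrightarrow> c \<le> j" for j
  proof -
    have "lower_central H j = {\<one>\<^bsub>H\<^esub>} \<longleftrightarrow> h ` U j = h ` {\<one>\<^bsub>G\<^esub>}"
      by (simp add: lc)
    also have "\<dots> \<longleftrightarrow> U j = {\<one>\<^bsub>G\<^esub>}"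
      by (rule inj_on_image_eq_iff[OF inj U_subset]) simp
    finally show ?thesis
      using U_trivial_iff[OF c] by simp
  qed
  have "derived H (carrier H) \<noteq> carrier H"
  proof -
    have "h ` U (Suc 0) \<noteq> h ` carrier G"
      using derived_neq_carrier[OF c] derived_eq_U[OF c]
        inj_on_image_eq_iff[OF inj U_subset subset_refl] by simp
    then show ?thesis
      using lc[of "Suc 0"] unfolding lower_central_one surj by simp
  qed
  then have "camina_group H"
    using h.camina_condition_image[OF surj camina_condition_twisted[OF c]]
    by (simp add: camina_group_def h.H.is_group)
  moreover have "nilpotent_group H"
    using triv by (auto simp: nilpotent_group_def h.H.is_group)
  moreover have "nilpotency_class H = c"
    unfolding nilpotency_class_def triv by (rule Least_equality) simp_all
  ultimately show ?thesis
    by blast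
qed

theorem mainTheorem4:
  shows "(\<forall>c::nat. c \<ge> 2 \<longrightarrow>
            (\<exists>G::nat monoid. nilpotent_group G \<and> camina_group G \<and> nilpotency_class G = c))
       \<and> \<not> (\<exists>B::nat. \<forall>G::nat monoid.
              nilpotent_group G \<and> camina_condition G \<longrightarrow> nilpotency_class G \<le> B)"
proof (intro conjI allI impI notI)
  fix c :: nat assume "c \<ge> 2"
  then show "\<exists>G::nat monoid. nilpotent_group G \<and> camina_group G \<and> nilpotency_class G = c"
    by (intro camina_group_of_class) simp
next
  assume "\<exists>B::nat. \<forall>G::nat monoid.
    nilpotent_group G \<and> camina_condition G \<longrightarrow> nilpotency_class G \<le> B"
  then obtain B where B: "\<And>G::nat monoid. nilpotent_group G \<Longrightarrow> camina_condition G \<Longrightarrow>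
    nilpotency_class G \<le> B"
    by blast
  \<comment> \<open>The bound \<open>B\<close> may be 0, so examples of class 1 are wanted here as
    well.\<close>
  obtain G :: "nat monoid"
    where "nilpotent_group G" "camina_group G" "nilpotency_class G = Suc B"
    using camina_group_of_class[of "Suc B"] by auto
  then show False
    using B[of G] by (simp add: camina_group_def)
qed

end
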